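(* Consider a network of $N\ge 2$ qubits whose topology is a chain graph (qubit $i$ and qubit $i+1$ are neighbors for $i=1,\dots,N-1$, with no other edges). Let the pure state $|\psi_i(t)\rangle\in\mathbb{C}^2$, $\langle\psi_i|\psi_i\rangle=1$, of each qubit evolve according to $$\frac{d}{dt}|\psi_i(t)\rangle=-i\mathbf{H}_i|\psi_i(t)\rangle,\qquad i=1,\dots,N,$$ with Hamiltonian $\mathbf{H}_i=\mathbf{n}_i\cdot\vec{\bm{\sigma}}=\sum_{p=1}^{3}\mathbf{n}_i^{(p)}\bm{\sigma}_p$, where for $p=1,2,3$ $$\mathbf{n}^{(p)}_{i}=\begin{cases}\mathfrak{R}\left(i\langle\psi_{1}|\bm{\sigma}_{p}|\psi_{2}\rangle\right), & i=1,\\ \mathfrak{R}\left(i\langle\psi_{i}|\bm{\sigma}_{p}|\psi_{i+1}\rangle\right)-\mathfrak{R}\left(i\langle\psi_{i-1}|\bm{\sigma}_{p}|\psi_{i}\rangle\right), & i=2,\dots,N-1,\\ -\mathfrak{R}\left(i\langle\psi_{N-1}|\bm{\sigma}_{p}|\psi_{N}\rangle\right), & i=N\end{cases}$$ (the factor $i$ inside $\mathfrak{R}(\cdot)$ is the imaginary unit). Then partial quantum consensus is achieved globally: for all initial states, the pure-state density matrices $\bm{\rho}'_i(t)=|\psi_i(t)\rangle\langle\psi_i(t)|$ satisfy $\bm{\rho}'_i(t)-\bm{\rho}'_j(t)\to 0$ as $t\to\infty$ for all $i,j\in\{1,\dots,N\}$.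
   Context: $\mathfrak{R}(\cdot)$ denotes the real part. Pauli matrices: $\bm{\sigma}_1=\begin{pmatrix}0&1\\1&0\end{pmatrix}$, $\bm{\sigma}_2=\begin{pmatrix}0&-i\\i&0\end{pmatrix}$, $\bm{\sigma}_3=\begin{pmatrix}1&0\\0&-1\end{pmatrix}$. Each qubit's (possibly mixed) state is a density matrix $\bm{\rho}_i=\frac12(\mathbf{I}_2+\mathbf{p}_i\cdot\vec{\bm{\sigma}})$ with $0\le\|\mathbf{p}_i\|\le1$, written as $\bm{\rho}_i=P\frac12\mathbf{I}_2+(1-P)\bm{\rho}'_i$, where $\bm{\rho}'_i=\frac12(\mathbf{I}_2+\frac{\mathbf{p}_i}{\|\mathbf{p}_i\|}\cdot\vec{\bm{\sigma}})=|\psi_i\rangle\langle\psi_i|$ is its pure-state part. Partial quantum consensus means that all pure-state parts agree, $\bm{\rho}'_1=\dots=\bm{\rho}'_N$ (all states point in the same direction in the Bloch ball); it is achieved asymptotically as $t\to\infty$. *)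

theory Defs
  imports "HOL-Analysis.Analysis"
begin

definition pauli :: "3 \<Rightarrow> complex^2^2" where
  "pauli p =
     (if p = 1 then vector [vector [0, 1], vector [1, 0]]
      else if p = 2 then vector [vector [0, - \<i>], vector [\<i>, 0]]
      else vector [vector [1, 0], vector [0, - 1]])"

text \<open>Bra-ket convention: conjugate-linear in the first argument.  The operation \<open>\<bullet>\<close> that
  the library provides on \<^typ>\<open>complex^2\<close> is only the real part of this Hermitian product.\<close>

definition braket :: "complex^2 \<Rightarrow> complex^2 \<Rightarrow> complex" where
  "braket \<phi> \<psi> = (\<Sum>k\<in>UNIV. cnj (\<phi> $ k) * \<psi> $ k)"

definition ketbra :: "complex^2 \<Rightarrow> complex^2 \<Rightarrow> complex^2^2" where
  "ketbra \<phi> \<psi> = (\<chi> r c. \<phi> $ r * cnj (\<psi> $ c))"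

definition pure_density :: "complex^2 \<Rightarrow> complex^2^2" where
  "pure_density \<psi> = ketbra \<psi> \<psi>"

definition coupling :: "complex^2 \<Rightarrow> complex^2 \<Rightarrow> real^3" where
  "coupling \<phi> \<psi> = (\<chi> p. Re (\<i> * braket \<phi> (pauli p *v \<psi>)))"

text \<open>The qubits of the chain are numbered \<open>1, \<dots>, N\<close> with \<open>N \<ge> 2\<close>; \<open>\<psi>\<close> is the
  configuration of all qubits at one instant.\<close>

definition chain_control :: "nat \<Rightarrow> (nat \<Rightarrow> complex^2) \<Rightarrow> nat \<Rightarrow> real^3" where
  "chain_control N \<psi> i =
     (if i = 1 then coupling (\<psi> 1) (\<psi> 2)
      else if i = N then - coupling (\<psi> (N - 1)) (\<psi> N)
      else coupling (\<psi> i) (\<psi> (i + 1)) - coupling (\<psi> (i - 1)) (\<psi> i))"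

definition chain_hamiltonian :: "nat \<Rightarrow> (nat \<Rightarrow> complex^2) \<Rightarrow> nat \<Rightarrow> complex^2^2" where
  "chain_hamiltonian N \<psi> i = (\<Sum>p\<in>UNIV. (chain_control N \<psi> i $ p) *\<^sub>R pauli p)"

text \<open>Consensus of the pure-state parts of the density matrices, reached asymptotically.\<close>

definition partial_quantum_consensus :: "nat \<Rightarrow> (nat \<Rightarrow> real \<Rightarrow> complex^2) \<Rightarrow> bool" where
  "partial_quantum_consensus N \<psi> \<longleftrightarrow>
     (\<forall>i\<in>{1..N}. \<forall>j\<in>{1..N}.
        ((\<lambda>t. pure_density (\<psi> i t) - pure_density (\<psi> j t)) \<longlongrightarrow> 0) at_top)"

end

theory Submission
  imports Defs
begin

text \<open>Since \<open>\<Sum>\<^sub>p tr(\<sigma>\<^sub>p X) \<sigma>\<^sub>p = 2 X - tr(X) I\<close>, on the unit sphere of \<open>\<complex>\<^sup>2 = \<real>\<^sup>4\<close> the dynamics reduces to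
  \<open>x\<^sub>i' = P(x\<^sub>i, x\<^sub>i\<^sub>+\<^sub>1) + P(x\<^sub>i, x\<^sub>i\<^sub>-\<^sub>1)\<close>, where \<open>P(a, b) = b - (a \<bullet> b) a\<close>.  This is the gradient flow of
  \<open>V = \<Sum>\<^sub>i x\<^sub>i \<bullet> x\<^sub>i\<^sub>+\<^sub>1\<close>, so \<open>V' = \<Sum>\<^sub>i |x\<^sub>i'|\<^sup>2\<close>; as \<open>V\<close> is bounded and \<open>V'\<close> is Lipschitz, all velocities tend to
  \<open>0\<close>.  At the end of the chain there is a single neighbour, so \<open>P(x\<^sub>1, x\<^sub>2) \<rightarrow> 0\<close>, and as
  \<open>|P(a, b)| = |P(b, a)|\<close> this propagates along the chain.  Thus neighbours become parallel up to sign,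
  and the sign is invisible to the density matrices.\<close>

section \<open>Gradient flow of a chain on the unit sphere\<close>

text \<open>A form of Barbalat's lemma. \<open>V\<close> is nondecreasing and bounded, so its late
  increments are small; a large value of \<open>f\<close> would persist for a fixed time by the
  Lipschitz bound and force a larger increment.\<close>

lemma barbalat_lipschitz:
  fixes V f :: "real \<Rightarrow> real"
  assumes deriv: "\<And>t. t \<ge> 0 \<Longrightarrow> (V has_real_derivative f t) (at t within {0..})"
    and bound: "\<And>t. t \<ge> 0 \<Longrightarrow> V t \<le> B"
    and nonneg: "\<And>t. t \<ge> 0 \<Longrightarrow> 0 \<le> f t"
    and lip: "K-lipschitz_on {0..} f"
  shows "(f \<longlongrightarrow> 0) at_top"
proof -
  have mvt: "\<exists>u\<in>{s..t}. V t - V s = (t - s) * f u" if "0 \<le> s" "s \<le> t" for s t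
  proof -
    have "(V has_derivative (\<lambda>h. h * f u)) (at u within {s..t})" if "s \<le> u" "u \<le> t" for u
      using deriv[of u] that \<open>0 \<le> s\<close>
      by (auto simp: has_field_derivative_def mult.commute[of _ "f u"] intro: has_derivative_subset)
    from mvt_very_simple[OF \<open>s \<le> t\<close> this] show ?thesis by blast
  qed
  have mono: "V s \<le> V t" if "0 \<le> s" "s \<le> t" for s t
    using mvt[OF that] nonneg that by (smt (verit) atLeastAtMost_iff mult_nonneg_nonneg)
  have K0: "0 \<le> K" using lip by (rule lipschitz_on_nonneg)
  have bdd: "bdd_above (V ` {0..})" using bound by (auto intro!: bdd_aboveI)
  show ?thesis
  proof (rule tendstoI)
    fix e :: real assume e: "e > 0"
    \<comment> \<open>Over a time \<open>h\<close>, \<open>f\<close> drops by at most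
      \<open>e / 2\<close>. The \<open>+ 1\<close> covers the case \<open>K = 0\<close>.\<close>
    define h where "h = e / (2 * (K + 1))"
    have h: "h > 0" "K * h \<le> e / 2"
      using e K0 by (auto simp: h_def field_simps)
    have "Sup (V ` {0..}) - h * (e / 2) < Sup (V ` {0..})" using e h by simp
    \<comment> \<open>After time \<open>T\<close>, less than \<open>h * (e / 2)\<close> of growth is
      left for \<open>V\<close>.\<close>
    then obtain T where T: "T \<ge> 0" "Sup (V ` {0..}) - h * (e / 2) < V T"
      using less_cSup_iff[OF _ bdd] by auto
    have "dist (f t) 0 < e" if tT: "t \<ge> T" for t
    proof (rule ccontr)
      assume "\<not> dist (f t) 0 < e"
      then have ft: "e \<le> f t" using nonneg[of t] that T by auto
      obtain u where u: "u \<in> {t..t+h}" "V (t + h) - V t = h * f u"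
        using mvt[of t "t + h", OF order_trans[OF T(1) tT]] h by auto
      have "\<bar>f u - f t\<bar> \<le> K * \<bar>u - t\<bar>"
        using lipschitz_onD[OF lip, of u t] u that T by (auto simp: dist_real_def)
      also have "\<dots> \<le> K * h" using u K0 by (intro mult_left_mono) auto
      finally have "e / 2 \<le> f u" using h ft by linarith
      then have "h * (e / 2) \<le> V (t + h) - V t" using u h by simp
      moreover have "V T \<le> V t" using mono T that by simp
      moreover have "V (t + h) \<le> Sup (V ` {0..})"
        using that T h by (intro cSup_upper bdd) auto
      ultimately show False using T by linarith
    qed
    then show "\<forall>\<^sub>F t in at_top. dist (f t) 0 < e"
      by (auto simp: eventually_at_top_linorder)
  qed
qed

section \<open>Projection onto tangent spaces of the unit sphere\<close>

definition tangent_part :: "'a::real_inner \<Rightarrow> 'a \<Rightarrow> 'a" where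
  "tangent_part a b = b - (a \<bullet> b) *\<^sub>R a"

lemma tangent_part_orthogonal: "norm a = 1 \<Longrightarrow> tangent_part a b \<bullet> a = 0"
  by (simp add: tangent_part_def inner_diff_left dot_square_norm inner_commute[of b a])

text \<open>This is the squared sine of the angle, so it vanishes exactly when the unit vectors
  agree up to sign.\<close>

lemma norm_tangent_part_squared:
  assumes "norm a = 1" "norm b = 1"
  shows "(norm (tangent_part a b))\<^sup>2 = 1 - (a \<bullet> b)\<^sup>2"
proof -
  have "(norm (tangent_part a b))\<^sup>2 = tangent_part a b \<bullet> tangent_part a b"
    by (simp add: dot_square_norm)
  also have "\<dots> = b \<bullet> b - 2 * (a \<bullet> b)\<^sup>2 + (a \<bullet> b)\<^sup>2 * (a \<bullet> a)"
    by (simp add: tangent_part_def algebra_simps inner_commute power2_eq_square)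
  finally show ?thesis using assms by (simp add: dot_square_norm)
qed

lemma norm_tangent_part_commute:
  assumes "norm a = 1" "norm b = 1"
  shows "norm (tangent_part a b) = norm (tangent_part b a)"
proof -
  have "(norm (tangent_part a b))\<^sup>2 = (norm (tangent_part b a))\<^sup>2"
    using assms by (simp add: norm_tangent_part_squared inner_commute)
  then show ?thesis by simp
qed

lemma norm_tangent_part_le_1:
  assumes "norm a = 1" "norm b = 1"
  shows "norm (tangent_part a b) \<le> 1"
  by (rule power2_le_imp_le) (simp_all add: norm_tangent_part_squared[OF assms])

lemma norm_tangent_part_diff_le:
  assumes "norm a = 1" "norm b = 1" "norm a' = 1" "norm b' = 1"
  shows "norm (tangent_part a b - tangent_part a' b') \<le> 2 * norm (a - a') + 2 * norm (b - b')"
proof -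
  \<comment> \<open>Exchanging one argument at a time gives every summand a factor
    \<open>a - a'\<close> or \<open>b - b'\<close>.\<close>
  have eq: "tangent_part a b - tangent_part a' b' =
      (b - b') - (a \<bullet> b) *\<^sub>R (a - a') - ((a - a') \<bullet> b) *\<^sub>R a' - (a' \<bullet> (b - b')) *\<^sub>R a'"
    by (simp add: tangent_part_def algebra_simps)
  have "\<bar>a \<bullet> b\<bar> \<le> 1" "\<bar>(a - a') \<bullet> b\<bar> \<le> norm (a - a')" "\<bar>a' \<bullet> (b - b')\<bar> \<le> norm (b - b')"
    using Cauchy_Schwarz_ineq2[of a b] Cauchy_Schwarz_ineq2[of "a - a'" b]
      Cauchy_Schwarz_ineq2[of a' "b - b'"] assms by auto
  then have "norm ((a \<bullet> b) *\<^sub>R (a - a')) \<le> norm (a - a')"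
    "norm (((a - a') \<bullet> b) *\<^sub>R a') \<le> norm (a - a')"
    "norm ((a' \<bullet> (b - b')) *\<^sub>R a') \<le> norm (b - b')"
    using assms by (auto simp: mult_left_le_one_le)
  then show ?thesis
    unfolding eq
    using norm_triangle_ineq4[of "(b - b') - (a \<bullet> b) *\<^sub>R (a - a') - ((a - a') \<bullet> b) *\<^sub>R a'" "(a' \<bullet> (b - b')) *\<^sub>R a'"]
      norm_triangle_ineq4[of "(b - b') - (a \<bullet> b) *\<^sub>R (a - a')" "((a - a') \<bullet> b) *\<^sub>R a'"]
      norm_triangle_ineq4[of "b - b'" "(a \<bullet> b) *\<^sub>R (a - a')"]
    by linarith
qed

section \<open>The chain flow and its Lipschitz bounds\<close>

definition chain_velocity :: "nat \<Rightarrow> (nat \<Rightarrow> 'a::real_inner) \<Rightarrow> nat \<Rightarrow> 'a" where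
  "chain_velocity N x i =
     (if i < N then tangent_part (x i) (x (i + 1)) else 0) +
     (if 1 < i then tangent_part (x i) (x (i - 1)) else 0)"

locale sphere_chain =
  fixes N :: nat and x :: "nat \<Rightarrow> real \<Rightarrow> 'a::real_inner"
  assumes norm_1: "\<And>i t. i \<in> {1..N} \<Longrightarrow> t \<ge> 0 \<Longrightarrow> norm (x i t) = 1"
    and flow: "\<And>i t. i \<in> {1..N} \<Longrightarrow> t \<ge> 0 \<Longrightarrow>
      (x i has_vector_derivative chain_velocity N (\<lambda>k. x k t) i) (at t within {0..})"
begin

abbreviation v :: "nat \<Rightarrow> real \<Rightarrow> 'a" where
  "v i t \<equiv> chain_velocity N (\<lambda>k. x k t) i"

lemma norm_velocity_le: "i \<in> {1..N} \<Longrightarrow> t \<ge> 0 \<Longrightarrow> norm (v i t) \<le> 2"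
  unfolding chain_velocity_def
  by (rule order_trans[OF norm_triangle_ineq], rule order_trans[OF add_mono[of _ 1 _ 1]])
     (auto intro!: norm_tangent_part_le_1 norm_1)

lemma velocity_orthogonal: "i \<in> {1..N} \<Longrightarrow> t \<ge> 0 \<Longrightarrow> v i t \<bullet> x i t = 0"
  using tangent_part_orthogonal[OF norm_1[of i t]] by (simp add: chain_velocity_def inner_add_left)

lemma position_lipschitz:
  assumes i: "i \<in> {1..N}" and "s \<ge> 0" "t \<ge> 0"
  shows "norm (x i s - x i t) \<le> 2 * \<bar>s - t\<bar>"
proof -
  have "norm (x i s - x i t) \<le> 2 * norm (s - t)"
  proof (rule differentiable_bound[where S = "{0..}" and f' = "\<lambda>u h. h *\<^sub>R v i u"])
    show "onorm (\<lambda>h. h *\<^sub>R v i u) \<le> 2" if "u \<in> {0..}" for u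
      using norm_velocity_le[OF i, of u] that
      by (intro onorm_le) (simp add: mult.commute mult_left_mono)
  qed (use assms flow in \<open>auto simp: has_vector_derivative_def\<close>)
  then show ?thesis by simp
qed

text \<open>The constant is 2 * 2 + 2 * 2: \<open>norm_tangent_part_diff_le\<close> with both points
  moving at speed at most 2.\<close>

lemma tangent_part_lipschitz:
  assumes "i \<in> {1..N}" "j \<in> {1..N}" "s \<ge> 0" "t \<ge> 0"
  shows "norm (tangent_part (x i s) (x j s) - tangent_part (x i t) (x j t)) \<le> 8 * \<bar>s - t\<bar>"
  using norm_tangent_part_diff_le[of "x i s" "x j s" "x i t" "x j t"] norm_1 assms
    position_lipschitz[of i s t] position_lipschitz[of j s t] by force

lemma velocity_lipschitz:
  assumes "i \<in> {1..N}" "s \<ge> 0" "t \<ge> 0"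
  shows "norm (v i s - v i t) \<le> 16 * \<bar>s - t\<bar>"
proof -
  define R L where
    "R = (\<lambda>u. if i < N then tangent_part (x i u) (x (i + 1) u) else 0)" and
    "L = (\<lambda>u. if 1 < i then tangent_part (x i u) (x (i - 1) u) else 0)"
  have "norm (R s - R t) \<le> 8 * \<bar>s - t\<bar>" "norm (L s - L t) \<le> 8 * \<bar>s - t\<bar>"
    unfolding R_def L_def using assms by (auto intro!: tangent_part_lipschitz)
  moreover have "v i s - v i t = (R s - R t) + (L s - L t)"
    by (simp add: chain_velocity_def R_def L_def)
  ultimately show ?thesis
    using norm_triangle_ineq[of "R s - R t" "L s - L t"] by simp
qed

text \<open>Prepares the Lipschitz hypothesis of \<open>barbalat_lipschitz\<close>. A difference of
  squares factors into a sum of norm at most 4 and a difference controlled by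
  \<open>velocity_lipschitz\<close>.\<close>

lemma speed_squared_lipschitz:
  assumes "i \<in> {1..N}" "s \<ge> 0" "t \<ge> 0"
  shows "\<bar>v i s \<bullet> v i s - v i t \<bullet> v i t\<bar> \<le> 64 * \<bar>s - t\<bar>"
proof -
  have "v i s \<bullet> v i s - v i t \<bullet> v i t = (v i s + v i t) \<bullet> (v i s - v i t)"
    by (simp add: algebra_simps inner_commute)
  also have "\<bar>\<dots>\<bar> \<le> norm (v i s + v i t) * norm (v i s - v i t)"
    by (rule Cauchy_Schwarz_ineq2)
  also have "\<dots> \<le> 4 * (16 * \<bar>s - t\<bar>)"
    using norm_triangle_ineq[of "v i s" "v i t"] norm_velocity_le[of i s] norm_velocity_le[of i t] assms
    by (intro mult_mono velocity_lipschitz) auto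
  finally show ?thesis by simp
qed

section \<open>Alignment as a Lyapunov function\<close>

definition alignment :: "real \<Rightarrow> real" where
  "alignment t = (\<Sum>i\<in>{1..<N}. x i t \<bullet> x (i + 1) t)"

text \<open>Velocities are tangent to the sphere, so pairing one with a tangent part equals pairing
  it with the neighbour itself. Each edge is then met once from each end, as in the product rule for
  \<open>alignment\<close>.\<close>

lemma sum_speed_squared:
  assumes t: "t \<ge> 0"
  shows "(\<Sum>i\<in>{1..N}. v i t \<bullet> v i t) = (\<Sum>i\<in>{1..<N}. x i t \<bullet> v (i + 1) t + v i t \<bullet> x (i + 1) t)"
proof -
  have "v i t \<bullet> v i t = (if i < N then v i t \<bullet> x (i + 1) t else 0)
      + (if 1 < i then v i t \<bullet> x (i - 1) t else 0)" if "i \<in> {1..N}" for i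
  proof -
    have "v i t \<bullet> tangent_part (x i t) y = v i t \<bullet> y" for y
      using velocity_orthogonal[OF that t] by (simp add: tangent_part_def inner_diff_right)
    then show ?thesis
      \<comment> \<open>Only the second factor is unfolded; the first must stay a velocity for the
        orthogonality identity to apply.\<close>
      by (subst (2) chain_velocity_def) (simp add: inner_add_right)
  qed
  then have "(\<Sum>i\<in>{1..N}. v i t \<bullet> v i t) = (\<Sum>i\<in>{1..N}. if i < N then v i t \<bullet> x (i + 1) t else 0)
      + (\<Sum>i\<in>{1..N}. if 1 < i then v i t \<bullet> x (i - 1) t else 0)"
    by (simp add: sum.distrib)
  also have "(\<Sum>i\<in>{1..N}. if i < N then v i t \<bullet> x (i + 1) t else 0) =
      (\<Sum>i\<in>{1..<N}. v i t \<bullet> x (i + 1) t)"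
    by (rule sum.mono_neutral_cong_right) auto
  also have "(\<Sum>i\<in>{1..N}. if 1 < i then v i t \<bullet> x (i - 1) t else 0) =
      (\<Sum>i\<in>{Suc 1..<Suc N}. v i t \<bullet> x (i - 1) t)"
    by (rule sum.mono_neutral_cong_right) auto
  \<comment> \<open>An index shift by one files the left-neighbour terms under their edges.\<close>
  also have "\<dots> = (\<Sum>i\<in>{1..<N}. x i t \<bullet> v (i + 1) t)"
    by (subst sum.shift_bounds_Suc_ivl) (simp add: inner_commute)
  finally show ?thesis by (simp add: sum.distrib)
qed

lemma alignment_derivative:
  assumes "t \<ge> 0"
  shows "(alignment has_real_derivative (\<Sum>i\<in>{1..N}. v i t \<bullet> v i t)) (at t within {0..})"
proof -
  have "((\<lambda>t. x i t \<bullet> x (i + 1) t) has_vector_derivative x i t \<bullet> v (i + 1) t + v i t \<bullet> x (i + 1) t)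
      (at t within {0..})" if "i \<in> {1..<N}" for i
    using that assms
    by (intro bounded_bilinear.has_vector_derivative[OF bounded_bilinear_inner] flow) auto
  then show ?thesis
    unfolding alignment_def[abs_def] sum_speed_squared[OF assms] has_real_derivative_iff_has_vector_derivative
    by (intro has_vector_derivative_sum)
qed

lemma alignment_le:
  assumes "t \<ge> 0"
  shows "alignment t \<le> real (card {1..<N})"
proof -
  have "x i t \<bullet> x (i + 1) t \<le> 1" if "i \<in> {1..<N}" for i
    using norm_cauchy_schwarz[of "x i t" "x (i + 1) t"] norm_1[of i t] norm_1[of "i + 1" t] that assms
    by simp
  then show ?thesis
    unfolding alignment_def using sum_bounded_above[of "{1..<N}" _ "1::real"] by simp
qed

lemma velocity_tendsto_0:
  assumes i: "i \<in> {1..N}"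
  shows "(v i \<longlongrightarrow> 0) at_top"
proof -
  define f where "f = (\<lambda>t. \<Sum>i\<in>{1..N}. v i t \<bullet> v i t)"
  have lip: "(real (card {1..N}) * 64)-lipschitz_on {0..} f"
  proof (rule lipschitz_onI)
    fix s t :: real assume "s \<in> {0..}" "t \<in> {0..}"
    then have "(\<Sum>i\<in>{1..N}. \<bar>v i s \<bullet> v i s - v i t \<bullet> v i t\<bar>) \<le> real (card {1..N}) * (64 * \<bar>s - t\<bar>)"
      by (intro sum_bounded_above speed_squared_lipschitz) auto
    moreover have "dist (f s) (f t) \<le> (\<Sum>i\<in>{1..N}. \<bar>v i s \<bullet> v i s - v i t \<bullet> v i t\<bar>)"
      unfolding dist_real_def f_def sum_subtractf[symmetric] by (rule sum_abs)
    ultimately show "dist (f s) (f t) \<le> (real (card {1..N}) * 64) * dist s t"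
      by (simp add: dist_real_def)
  qed simp
  have f: "(f \<longlongrightarrow> 0) at_top"
    by (rule barbalat_lipschitz[OF _ alignment_le _ lip])
       (simp_all add: f_def alignment_derivative sum_nonneg del: One_nat_def)
  have "(norm (v i t))\<^sup>2 \<le> f t" for t
    unfolding f_def power2_norm_eq_inner using i by (intro member_le_sum) auto
  then have "\<forall>\<^sub>F t in at_top. norm (norm (v i t) ^ 2) \<le> f t"
    by simp
  from Lim_null_comparison[OF this f] have "((\<lambda>t. sqrt ((norm (v i t))\<^sup>2)) \<longlongrightarrow> sqrt 0) at_top"
    by (rule tendsto_real_sqrt)
  then show ?thesis
    by (simp add: tendsto_norm_zero_iff)
qed

lemma tangent_part_tendsto_0:
  assumes "1 \<le> i" "i < N"
  shows "((\<lambda>t. tangent_part (x i t) (x (i + 1) t)) \<longlongrightarrow> 0) at_top"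
  using assms
proof (induction i rule: nat_induct_at_least)
  case base
  \<comment> \<open>Vertex 1 has one neighbour, so its velocity is exactly the forward tangent
    part.\<close>
  then show ?case using velocity_tendsto_0[of 1] by (simp add: chain_velocity_def)
next
  case (Suc i)
  have "((\<lambda>t. norm (tangent_part (x i t) (x (i + 1) t))) \<longlongrightarrow> 0) at_top"
    using Suc by (intro tendsto_norm_zero) auto
  \<comment> \<open>The symmetry turns decay seen from vertex \<open>i\<close> into decay seen from
    \<open>Suc i\<close>. Unit norms are known for \<open>t \<ge> 0\<close> only, hence
    "eventually".\<close>
  moreover have "\<forall>\<^sub>F t in at_top. norm (tangent_part (x i t) (x (i + 1) t)) =
      norm (tangent_part (x (Suc i) t) (x i t))"
    using Suc by (intro eventually_mono[OF eventually_ge_at_top[of 0]])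
      (auto intro!: norm_tangent_part_commute norm_1)
  ultimately have "((\<lambda>t. norm (tangent_part (x (Suc i) t) (x i t))) \<longlongrightarrow> 0) at_top"
    by (rule Lim_transform_eventually)
  then have "((\<lambda>t. tangent_part (x (Suc i) t) (x i t)) \<longlongrightarrow> 0) at_top"
    by (rule tendsto_norm_zero_cancel)
  moreover have "(v (Suc i) \<longlongrightarrow> 0) at_top"
    using Suc by (intro velocity_tendsto_0) auto
  \<comment> \<open>Subtracting the backward part from the velocity leaves the forward part.\<close>
  ultimately have "((\<lambda>t. v (Suc i) t - tangent_part (x (Suc i) t) (x i t)) \<longlongrightarrow> 0 - 0) at_top"
    by (rule tendsto_diff[rotated])
  then show ?case using Suc by (simp add: chain_velocity_def)
qed

end

section \<open>Qubits\<close>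

text \<open>Write \<open>y = a x + e\<close> with \<open>e\<close> the tangent part. In the
  difference, \<open>x $ r * cnj (x $ c)\<close> has coefficient \<open>1 - a^2\<close>, the squared
  norm of \<open>e\<close>, blind to the sign of \<open>a\<close>; the other three terms contain
  \<open>e\<close>. Each of the four is at most \<open>norm e \<le> 1\<close>.\<close>

lemma norm_pure_density_diff_component_le:
  assumes x: "norm x = 1" and y: "norm y = 1"
  shows "norm (pure_density x $ r $ c - pure_density y $ r $ c) \<le> 4 * norm (tangent_part x y)"
proof -
  define e where "e = tangent_part x y"
  define a where "a = x \<bullet> y"
  have y_eq: "y $ k = a *\<^sub>R x $ k + e $ k" for k
    by (simp add: e_def a_def tangent_part_def)
  have e1: "norm e \<le> 1" unfolding e_def using x y by (rule norm_tangent_part_le_1)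
  have e2: "(norm e)\<^sup>2 = 1 - a\<^sup>2" unfolding e_def a_def using x y by (rule norm_tangent_part_squared)
  have a1: "\<bar>a\<bar> \<le> 1" using Cauchy_Schwarz_ineq2[of x y] x y by (simp add: a_def)
  have comp: "norm (x $ k) \<le> 1" "norm (e $ k) \<le> norm e" for k
    using Finite_Cartesian_Product.norm_nth_le[of x k]
      Finite_Cartesian_Product.norm_nth_le[of e k] x by auto
  have "pure_density x $ r $ c - pure_density y $ r $ c =
      (norm e)\<^sup>2 *\<^sub>R (x $ r * cnj (x $ c)) - a *\<^sub>R (x $ r * cnj (e $ c))
      - a *\<^sub>R (e $ r * cnj (x $ c)) - e $ r * cnj (e $ c)"
    unfolding e2 by (simp add: pure_density_def ketbra_def y_eq algebra_simps power2_eq_square)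
  also have "norm \<dots> \<le> norm e + norm e + norm e + norm e"
  proof -
    have "norm e * norm e \<le> norm e" using e1 by (simp add: mult_left_le_one_le)
    then have "norm ((norm e)\<^sup>2 *\<^sub>R (x $ r * cnj (x $ c))) \<le> norm e"
      using mult_mono[OF \<open>norm e * norm e \<le> norm e\<close> mult_mono[OF comp(1)[of r] comp(1)[of c]]]
      by (simp add: norm_mult power2_eq_square)
    moreover have "norm (a *\<^sub>R (x $ r * cnj (e $ c))) \<le> norm e"
      using mult_mono[OF a1 mult_mono[OF comp(1)[of r] comp(2)[of c]]] by (simp add: norm_mult)
    moreover have "norm (a *\<^sub>R (e $ r * cnj (x $ c))) \<le> norm e"
      using mult_mono[OF a1 mult_mono[OF comp(2)[of r] comp(1)[of c]]] by (simp add: norm_mult)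
    moreover have "norm (e $ r * cnj (e $ c)) \<le> norm e"
      using mult_mono[OF comp(2)[of r] order_trans[OF comp(2)[of c] e1]] by (simp add: norm_mult)
    ultimately show ?thesis
      by (intro order_trans[OF norm_triangle_ineq4] add_mono) auto
  qed
  finally show ?thesis by (simp add: e_def)
qed

lemma pure_density_diff_tendsto_0:
  assumes "((\<lambda>t. tangent_part (x t) (y t)) \<longlongrightarrow> 0) F"
    and "\<forall>\<^sub>F t in F. norm (x t) = 1 \<and> norm (y t) = 1"
  shows "((\<lambda>t. pure_density (x t) - pure_density (y t)) \<longlongrightarrow> 0) F"
proof (intro vec_tendstoI)
  fix r c
  have "((\<lambda>t. 4 * norm (tangent_part (x t) (y t))) \<longlongrightarrow> 4 * 0) F"
    by (intro tendsto_intros tendsto_norm_zero assms)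
  then show "((\<lambda>t. (pure_density (x t) - pure_density (y t)) $ r $ c) \<longlongrightarrow> 0 $ r $ c) F"
    using assms(2)
    by (auto intro!: Lim_null_comparison[where g = "\<lambda>t. 4 * norm (tangent_part (x t) (y t))"]
        norm_pure_density_diff_component_le elim!: eventually_mono)
qed

section \<open>From the Hamiltonian to the tangential flow\<close>

lemma inner_eq_Re_braket: "x \<bullet> y = Re (braket x y)"
  by (simp add: inner_vec_def braket_def inner_complex_def)

text \<open>\<open>coupling a b $ p\<close> is half the trace of \<open>sigma_p X\<close> for
  \<open>X = i (|b><a| - |a><b|)\<close>, so Pauli completeness gives the sum as
  \<open>X - tr(X)/2 I\<close>. The proof compares real and imaginary parts of coordinates.\<close>

lemma coupling_left:
  "(- \<i>) *s ((\<Sum>p\<in>UNIV. (coupling a b $ p) *\<^sub>R pauli p) *v a) = (a \<bullet> a) *\<^sub>R b - (a \<bullet> b) *\<^sub>R a"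
  by (simp add: vec_eq_iff forall_2 sum_3 sum_2 coupling_def braket_def pauli_def inner_vec_def
      inner_complex_def matrix_vector_mult_def complex_eq_iff algebra_simps)

text \<open>Since \<open><b|sigma_p|a>\<close> is the conjugate of \<open><a|sigma_p|b>\<close>,
  \<open>- coupling a b = coupling b a\<close>: this is \<open>coupling_left\<close> seen from the
  other end of the edge.\<close>

lemma coupling_right:
  "(- \<i>) *s ((\<Sum>p\<in>UNIV. (- coupling a b $ p) *\<^sub>R pauli p) *v b) = (b \<bullet> b) *\<^sub>R a - (b \<bullet> a) *\<^sub>R b"
  by (simp add: vec_eq_iff forall_2 sum_3 sum_2 coupling_def braket_def pauli_def inner_vec_def
      inner_complex_def matrix_vector_mult_def complex_eq_iff algebra_simps)

text \<open>Stated without normalising the states, as conservation of the norm is derived from it.\<close>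

lemma chain_hamiltonian_action:
  assumes "N \<ge> 2" "i \<in> {1..N}"
  shows "(- \<i>) *s (chain_hamiltonian N x i *v x i) =
     (if i < N then (x i \<bullet> x i) *\<^sub>R x (i + 1) - (x i \<bullet> x (i + 1)) *\<^sub>R x i else 0) +
     (if 1 < i then (x i \<bullet> x i) *\<^sub>R x (i - 1) - (x i \<bullet> x (i - 1)) *\<^sub>R x i else 0)"
proof -
  have left: "i = 1 \<Longrightarrow> ?thesis"
    using assms coupling_left[of "x i" "x (i + 1)"]
    by (simp add: chain_hamiltonian_def chain_control_def numeral_2_eq_2)
  \<comment> \<open>\<open>chain_control\<close> tests \<open>i = 1\<close> first;
    \<open>N \<ge> 2\<close> keeps that branch apart from \<open>i = N\<close>.\<close>
  have right: "i = N \<Longrightarrow> ?thesis"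
    using assms coupling_right[of "x (i - 1)" "x i"]
    by (simp add: chain_hamiltonian_def chain_control_def)
  have mid: ?thesis if "1 < i" "i < N"
  proof -
    \<comment> \<open>The Hamiltonian is linear in the control, so an interior qubit splits into its
      two edges.\<close>
    have "chain_hamiltonian N x i = (\<Sum>p\<in>UNIV. (coupling (x i) (x (i + 1)) $ p) *\<^sub>R pauli p)
        + (\<Sum>p\<in>UNIV. (- coupling (x (i - 1)) (x i) $ p) *\<^sub>R pauli p)"
      using that
      by (simp add: chain_hamiltonian_def chain_control_def scaleR_diff_left sum_subtractf sum_negf)
    then show ?thesis
      using that coupling_left[of "x i" "x (i + 1)"] coupling_right[of "x (i - 1)" "x i"]
      by (simp only: matrix_vector_mult_add_rdistrib vector_add_ldistrib if_True)
  qed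
  show ?thesis using assms left right mid by force
qed

theorem theorem2:
  fixes N :: nat and \<psi> :: "nat \<Rightarrow> real \<Rightarrow> complex^2"
  assumes "N \<ge> 2"
    and "\<And>i. i \<in> {1..N} \<Longrightarrow> braket (\<psi> i 0) (\<psi> i 0) = 1"
    and "\<And>i t. i \<in> {1..N} \<Longrightarrow> t \<ge> 0 \<Longrightarrow>
           (\<psi> i has_vector_derivative
              (- \<i>) *s (chain_hamiltonian N (\<lambda>k. \<psi> k t) i *v \<psi> i t)) (at t within {0..})"
  shows "partial_quantum_consensus N \<psi>"
proof -
  have norm_1: "norm (\<psi> i t) = 1" if i: "i \<in> {1..N}" and t: "t \<ge> 0" for i t
  proof -
    have "((\<lambda>t. \<psi> i t \<bullet> \<psi> i t) has_vector_derivative 0) (at s within {0..})" if "s \<in> {0..}" for s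
    proof -
      define d where "d = (- \<i>) *s (chain_hamiltonian N (\<lambda>k. \<psi> k s) i *v \<psi> i s)"
      \<comment> \<open>For \<open>x\<close> of any norm,
        \<open>(x \<bullet> x) y - (x \<bullet> y) x\<close> is orthogonal to
        \<open>x\<close>.\<close>
      have "\<psi> i s \<bullet> d = 0"
        unfolding d_def chain_hamiltonian_action[OF assms(1) i, where x = "\<lambda>k. \<psi> k s"]
        by (simp add: inner_add_right inner_diff_right)
      then have "\<psi> i s \<bullet> d + d \<bullet> \<psi> i s = 0" by (simp add: inner_commute)
      moreover have "(\<psi> i has_vector_derivative d) (at s within {0..})"
        using assms(3)[OF i] that by (simp add: d_def)
      ultimately show ?thesis
        using bounded_bilinear.has_vector_derivative[OF bounded_bilinear_inner, of "\<psi> i" d s "{0..}" "\<psi> i" d]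
        by simp
    qed
    then obtain k where k: "\<And>s. s \<in> {0..} \<Longrightarrow> \<psi> i s \<bullet> \<psi> i s = k"
      using has_vector_derivative_zero_constant[of "{0::real..}" "\<lambda>t. \<psi> i t \<bullet> \<psi> i t"] by auto
    have "k = 1" using k[of 0] assms(2)[OF i] by (simp add: inner_eq_Re_braket)
    then show ?thesis using k[of t] t by (simp add: norm_eq_sqrt_inner)
  qed
  interpret sphere_chain N \<psi>
  proof
    fix i and t :: real assume i: "i \<in> {1..N}" and t: "t \<ge> 0"
    have "(- \<i>) *s (chain_hamiltonian N (\<lambda>k. \<psi> k t) i *v \<psi> i t) = chain_velocity N (\<lambda>k. \<psi> k t) i"
      unfolding chain_hamiltonian_action[OF assms(1) i, where x = "\<lambda>k. \<psi> k t"]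
      by (simp add: chain_velocity_def tangent_part_def dot_square_norm norm_1[OF i t])
    then show "(\<psi> i has_vector_derivative chain_velocity N (\<lambda>k. \<psi> k t) i) (at t within {0..})"
      using assms(3)[OF i t] by simp
  qed (rule norm_1)
  \<comment> \<open>Qubit 1 serves as common reference: neighbour differences telescope along the
    chain, and any pair is then compared through it.\<close>
  have first: "((\<lambda>t. pure_density (\<psi> 1 t) - pure_density (\<psi> i t)) \<longlongrightarrow> 0) at_top"
    if "1 \<le> i" "i \<le> N" for i
    using that
  proof (induction i rule: nat_induct_at_least)
    case base
    then show ?case by simp
  next
    case (Suc i)
    have "((\<lambda>t. pure_density (\<psi> i t) - pure_density (\<psi> (i + 1) t)) \<longlongrightarrow> 0) at_top"
      using Suc by (intro pure_density_diff_tendsto_0 tangent_part_tendsto_0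
          eventually_mono[OF eventually_ge_at_top[of 0]]) (auto intro!: norm_1)
    from tendsto_add[OF Suc.IH this] Suc show ?case by simp
  qed
  show ?thesis
    unfolding partial_quantum_consensus_def
  proof (intro ballI)
    fix i j assume "i \<in> {1..N}" "j \<in> {1..N}"
    then have "((\<lambda>t. (pure_density (\<psi> 1 t) - pure_density (\<psi> j t))
        - (pure_density (\<psi> 1 t) - pure_density (\<psi> i t))) \<longlongrightarrow> 0 - 0) at_top"
      by (intro tendsto_diff first) auto
    then show "((\<lambda>t. pure_density (\<psi> i t) - pure_density (\<psi> j t)) \<longlongrightarrow> 0) at_top"
      by simp
  qed
qed

end
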